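(* Let $F\colon\mathbb R^n\times\mathbb R^m\to\mathbb R^p$ be continuous, let $\mathcal K\subset\mathbb R^p$ be a nonempty, closed, convex, pointed cone with nonempty interior, let $X\subset\mathbb R^n$ be nonempty and closed, and let $\widehat\Psi\colon\mathbb R^n\rightrightarrows\mathbb R^m$ be a set-valued (lower-level solution) mapping. Let $\operatorname{gph}\widehat\Psi$ be closed and let $\operatorname{gph}\widehat\Psi\cap(X\times\mathbb R^m)$ be nonempty and bounded. Then there exist an efficient and a weakly efficient point of the multiobjective bilevel optimization problem $$\min_{x,y}{}_{\mathcal K}\{F(x,y)\mid x\in X,\ y\in\widehat\Psi(x)\}.$$
   Context: $\operatorname{gph}\widehat\Psi:=\{(x,y)\mid y\in\widehat\Psi(x)\}$. With feasible set $S:=\{(x,y)\mid x\in X,\ y\in\widehat\Psi(x)\}$, a point $(\bar x,\bar y)\in S$ is efficient if $(\{F(\bar x,\bar y)\}-\mathcal K\setminus\{0\})\cap F(S)=\emptyset$, and weakly efficient if $(\{F(\bar x,\bar y)\}-\operatorname{int}\mathcal K)\cap F(S)=\emptyset$. *)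

theory Defs
  imports "HOL-Analysis.Analysis"
begin

definition graph :: "('a \<Rightarrow> 'b set) \<Rightarrow> ('a \<times> 'b) set" where
  "graph \<Psi> = {(x, y). y \<in> \<Psi> x}"

definition pointed :: "'c::real_vector set \<Rightarrow> bool" where
  "pointed K \<longleftrightarrow> K \<inter> uminus ` K = {0}"

definition bilevel_feasible :: "'a set \<Rightarrow> ('a \<Rightarrow> 'b set) \<Rightarrow> ('a \<times> 'b) set" where
  "bilevel_feasible X \<Psi> = {(x, y). x \<in> X \<and> y \<in> \<Psi> x}"

text \<open>
  Minimisation of \<open>F\<close> over \<open>S\<close> with respect to the ordering cone \<open>K\<close>. The image \<open>(-) a ` A\<close>
  is the Minkowski difference of \<open>{a}\<close> and \<open>A\<close>; in \<open>K - {0}\<close> the minus is set difference.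
\<close>

definition efficient_point ::
    "('z \<Rightarrow> 'c::real_vector) \<Rightarrow> 'c set \<Rightarrow> 'z set \<Rightarrow> 'z \<Rightarrow> bool" where
  "efficient_point F K S z \<longleftrightarrow> z \<in> S \<and> ((-) (F z) ` (K - {0})) \<inter> F ` S = {}"

definition weakly_efficient_point ::
    "('z \<Rightarrow> 'c::real_normed_vector) \<Rightarrow> 'c set \<Rightarrow> 'z set \<Rightarrow> 'z \<Rightarrow> bool" where
  "weakly_efficient_point F K S z \<longleftrightarrow> z \<in> S \<and> ((-) (F z) ` interior K) \<inter> F ` S = {}"

end

theory Submission
  imports Defs
begin

text \<open>
  The convex hull of the unit vectors of a closed convex pointed cone \<open>K\<close> is compact and misses
  the origin, so separating it from the origin yields a linear functional that is strictly positive
  on \<open>K - {0}\<close>. A minimiser of this functional composed with \<open>F\<close> over the compact feasible set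
  is efficient, and it is weakly efficient because \<open>interior K \<subseteq> K - {0}\<close>.
\<close>

text \<open>If a convex combination of two nonzero elements vanished, then
  \<open>u *\<^sub>R x\<close> would be the negative of an element of \<open>K\<close>. Pointedness
  makes it zero, so both weights vanish, although they sum to 1.\<close>

lemma convex_pointed_cone_minus_zero:
  fixes K :: "'a::real_vector set"
  assumes "convex K" "cone K" "pointed K"
  shows "convex (K - {0})"
proof (rule convexI)
  fix x y :: 'a and u v :: real
  assume xy: "x \<in> K - {0}" "y \<in> K - {0}" and uv: "0 \<le> u" "0 \<le> v" "u + v = 1"
  have K: "u *\<^sub>R x \<in> K" "v *\<^sub>R y \<in> K"
    using xy uv \<open>cone K\<close> by (auto simp: cone_def)
  have "u *\<^sub>R x + v *\<^sub>R y \<noteq> 0"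
  proof
    assume "u *\<^sub>R x + v *\<^sub>R y = 0"
    then have "u *\<^sub>R x = - (v *\<^sub>R y)"
      by (simp add: eq_neg_iff_add_eq_0)
    then have "u *\<^sub>R x = 0"
      using K \<open>pointed K\<close> unfolding pointed_def by blast
    with \<open>u *\<^sub>R x = - (v *\<^sub>R y)\<close> have "u = 0" "v = 0"
      using xy by auto
    with uv show False by simp
  qed
  moreover have "u *\<^sub>R x + v *\<^sub>R y \<in> K"
    using xy uv \<open>convex K\<close> by (auto intro: convexD)
  ultimately show "u *\<^sub>R x + v *\<^sub>R y \<in> K - {0}" by simp
qed

lemma pointed_cone_strictly_positive_functional:
  fixes K :: "'a::euclidean_space set"
  assumes "closed K" "convex K" "cone K" "pointed K"
  obtains a where "\<And>k. k \<in> K - {0} \<Longrightarrow> 0 < a \<bullet> k"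
proof -
  \<comment> \<open>The unit vectors of \<open>K\<close> form a compact set, and in finite dimension
    so does their hull. Closedness is what allows a strict separation from the origin.\<close>
  define B where "B = convex hull (K \<inter> sphere 0 1)"
  have "compact B"
    unfolding B_def using \<open>closed K\<close> by (intro compact_convex_hull closed_Int_compact) auto
  moreover have "B \<subseteq> K - {0}"
    unfolding B_def
    \<comment> \<open>Pointedness enters here: \<open>K - {0}\<close> is convex and contains the
      generators, hence the whole hull.\<close>
    by (rule hull_minimal) (use convex_pointed_cone_minus_zero assms in auto)
  moreover have "convex B"
    unfolding B_def by (rule convex_convex_hull)
  ultimately obtain a b where ab: "a \<bullet> 0 < b" "\<And>x. x \<in> B \<Longrightarrow> b < a \<bullet> x"
    using separating_hyperplane_closed_point[of B 0] compact_imp_closed by blast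
  have "0 < a \<bullet> k" if "k \<in> K - {0}" for k
  proof -
    \<comment> \<open>Positivity on \<open>B\<close> reaches all of \<open>K - {0}\<close> by
      normalising \<open>k\<close>. On \<open>B\<close> it holds because
      \<open>b > a \<bullet> 0 = 0\<close>.\<close>
    have "(1 / norm k) *\<^sub>R k \<in> K \<inter> sphere 0 1"
      using that \<open>cone K\<close> by (auto simp: cone_def)
    then have "(1 / norm k) *\<^sub>R k \<in> B"
      unfolding B_def by (rule hull_inc)
    then have "0 < a \<bullet> ((1 / norm k) *\<^sub>R k)"
      using ab by force
    then show ?thesis
      using that by (simp add: zero_less_divide_iff)
  qed
  then show ?thesis by (rule that)
qed

text \<open>A ball around the origin inside \<open>K\<close> would contain some nonzero vector
  together with its negative.\<close>

lemma pointed_zero_notin_interior: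
  fixes K :: "'a::euclidean_space set"
  assumes "pointed K"
  shows "0 \<notin> interior K"
proof
  assume "0 \<in> interior K"
  then obtain e where e: "e > 0" "cball 0 e \<subseteq> K"
    by (auto simp: mem_interior_cball)
  obtain b :: 'a where b: "b \<in> Basis"
    using nonempty_Basis by blast
  have "e *\<^sub>R b \<in> K" "- (e *\<^sub>R b) \<in> K"
    using e b by (auto intro!: subsetD[OF e(2)])
  then have "e *\<^sub>R b \<in> K \<inter> uminus ` K"
    by (auto simp: image_iff intro!: bexI[of _ "- (e *\<^sub>R b)"])
  then show False
    using \<open>pointed K\<close> e b by (simp add: pointed_def nonzero_Basis del: Int_iff)
qed

lemma efficient_imp_weakly_efficient:
  fixes F :: "'z \<Rightarrow> 'c::euclidean_space"
  assumes "pointed K" "efficient_point F K S z"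
  shows "weakly_efficient_point F K S z"
proof -
  have "interior K \<subseteq> K - {0}"
    using pointed_zero_notin_interior[OF \<open>pointed K\<close>] interior_subset by blast
  then show ?thesis
    using assms unfolding efficient_point_def weakly_efficient_point_def by blast
qed

lemma efficient_point_exists:
  fixes F :: "'z::topological_space \<Rightarrow> 'c::euclidean_space"
  assumes "continuous_on S F" "compact S" "S \<noteq> {}"
    and "closed K" "convex K" "cone K" "pointed K"
  shows "\<exists>z. efficient_point F K S z"
proof -
  obtain a where a: "\<And>k. k \<in> K - {0} \<Longrightarrow> 0 < a \<bullet> k"
    using pointed_cone_strictly_positive_functional assms by blast
  have "continuous_on S (\<lambda>z. a \<bullet> F z)"
    using assms by (intro continuous_intros)
  then obtain z where z: "z \<in> S" "\<And>w. w \<in> S \<Longrightarrow> a \<bullet> F z \<le> a \<bullet> F w"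
    using continuous_attains_inf[OF \<open>compact S\<close> \<open>S \<noteq> {}\<close>] by blast
  have "F z - k \<noteq> F w" if "k \<in> K - {0}" "w \<in> S" for k w
  proof
    \<comment> \<open>Such a \<open>w\<close> would have a strictly smaller value of the functional
      than the minimiser \<open>z\<close>, since \<open>a \<bullet> k > 0\<close>.\<close>
    assume "F z - k = F w"
    then have "a \<bullet> F w = a \<bullet> F z - a \<bullet> k"
      by (metis inner_diff_right)
    then show False
      using a[OF that(1)] z(2)[OF that(2)] by simp
  qed
  with z(1) show ?thesis
    unfolding efficient_point_def by blast
qed

theorem theorem3p14:
  fixes F :: "(real ^ 'n) \<times> (real ^ 'm) \<Rightarrow> real ^ 'p"
    and K :: "(real ^ 'p) set"
    and X :: "(real ^ 'n) set"
    and \<Psi> :: "real ^ 'n \<Rightarrow> (real ^ 'm) set"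
  assumes "continuous_on UNIV F"
    and "K \<noteq> {}" and "closed K" and "convex K" and "cone K" and "pointed K"
    and "interior K \<noteq> {}"
    and "X \<noteq> {}" and "closed X"
    and "closed (graph \<Psi>)"
    and "graph \<Psi> \<inter> (X \<times> UNIV) \<noteq> {}" and "bounded (graph \<Psi> \<inter> (X \<times> UNIV))"
  shows "(\<exists>x y. efficient_point F K (bilevel_feasible X \<Psi>) (x, y)) \<and>
         (\<exists>x y. weakly_efficient_point F K (bilevel_feasible X \<Psi>) (x, y))"
proof -
  \<comment> \<open>In this form the feasible set is visibly closed, and with the boundedness
    hypothesis it is compact by Heine-Borel.\<close>
  have S: "bilevel_feasible X \<Psi> = graph \<Psi> \<inter> (X \<times> UNIV)"
    by (auto simp: bilevel_feasible_def graph_def)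
  have "compact (bilevel_feasible X \<Psi>)"
    unfolding S compact_eq_bounded_closed
    using assms by (auto intro: closed_Int closed_Times)
  moreover have "continuous_on (bilevel_feasible X \<Psi>) F"
    using assms(1) continuous_on_subset by blast
  moreover have "bilevel_feasible X \<Psi> \<noteq> {}"
    using assms S by simp
  ultimately obtain x y where "efficient_point F K (bilevel_feasible X \<Psi>) (x, y)"
    using efficient_point_exists assms by (metis surj_pair)
  moreover from this have "weakly_efficient_point F K (bilevel_feasible X \<Psi>) (x, y)"
    by (rule efficient_imp_weakly_efficient[OF \<open>pointed K\<close>])
  ultimately show ?thesis by blast
qed

end
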